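(* Let $K$ be a number field of degree $n$ over $\mathbb{Q}$ and let $O$ be an order of $K$. Let $O_n=\{\alpha\in O\mid\mathbb{Q}(\alpha)=K\}$ and let $A_O=\{\alpha\in O\mid \mathbb{Z}[\alpha]=O\}$ (a possibly empty subset of $O_n$). Then $O_n\setminus A_O$ is polynomially dense in $O$.
   Context: An order of a number field $K$ is a subring of $K$ which has maximal rank $[K:\mathbb{Q}]$ as a $\mathbb{Z}$-module; in particular it is contained in the ring of integers $O_K$ of $K$, and its quotient field is $K$. A subset $S$ of a domain $D$ with quotient field $F$ is polynomially dense in $D$ if $\{f\in F[X]\mid f(S)\subset D\}=\{f\in F[X]\mid f(D)\subset D\}$.
   Formalization: The degree n is assumed to be at least 2: for n = 1 one has K = Q, O = Z and O_1 \ A_O is empty, and the empty set is not polynomially dense in Z (X/2 is not integer-valued on Z). *)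

theory Defs
  imports Complex_Main "HOL-Computational_Algebra.Polynomial"
begin

text \<open>
  Number fields and their orders are represented as subsets of an arbitrary ambient field of
  characteristic 0; the ambient field may be the number field itself (\<^term>\<open>UNIV\<close>).
\<close>

definition is_subring :: "'a::ring_1 set \<Rightarrow> bool" where
  "is_subring R \<longleftrightarrow> 1 \<in> R \<and> (\<forall>x\<in>R. \<forall>y\<in>R. x - y \<in> R \<and> x * y \<in> R)"

definition is_subfield :: "'a::field set \<Rightarrow> bool" where
  "is_subfield K \<longleftrightarrow> is_subring K \<and> (\<forall>x\<in>K. inverse x \<in> K)"

definition scale_rat :: "rat \<Rightarrow> 'a::field_char_0 \<Rightarrow> 'a" where
  "scale_rat q x = of_rat q * x"

definition scale_int :: "int \<Rightarrow> 'a::ring_1 \<Rightarrow> 'a" where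
  "scale_int k x = of_int k * x"

lemma vector_space_scale_rat: "vector_space (scale_rat :: rat \<Rightarrow> 'a::field_char_0 \<Rightarrow> 'a)"
  by unfold_locales (simp_all add: scale_rat_def algebra_simps of_rat_add of_rat_mult)

lemma module_scale_int: "module (scale_int :: int \<Rightarrow> 'a::ring_1 \<Rightarrow> 'a)"
  by unfold_locales (simp_all add: scale_int_def algebra_simps)

definition number_field :: "'a::field_char_0 set \<Rightarrow> bool" where
  "number_field K \<longleftrightarrow> is_subfield K \<and> (\<exists>B. finite B \<and> module.span scale_rat B = K)"

definition degree_over_Q :: "'a::field_char_0 set \<Rightarrow> nat" where
  "degree_over_Q K = vector_space.dim scale_rat K"

text \<open>
  Having maximal rank $[K:Q]$ as a Z-module is read as being free of that rank.  For a Z-module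
  that is not finitely generated, a condition on the rank alone would admit subrings such as
  $Z[1/2]$ in Q, which are not contained in the ring of integers.
\<close>
definition is_order :: "'a::field_char_0 set \<Rightarrow> 'a set \<Rightarrow> bool" where
  "is_order K R \<longleftrightarrow> is_subring R \<and> R \<subseteq> K \<and>
     (\<exists>B. finite B \<and> card B = degree_over_Q K \<and>
          \<not> module.dependent scale_int B \<and> module.span scale_int B = R)"

definition Z_adjoin :: "'a::comm_ring_1 \<Rightarrow> 'a set" where
  "Z_adjoin \<alpha> = range (\<lambda>p :: int poly. poly (map_poly of_int p) \<alpha>)"

text \<open>
  The smallest subfield containing \<open>\<alpha>\<close>; in characteristic 0 every subfield contains Q.
\<close>
definition Q_adjoin :: "'a::field_char_0 \<Rightarrow> 'a set" where
  "Q_adjoin \<alpha> = is_subfield hull {\<alpha>}"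

definition field_generators :: "'a::field_char_0 set \<Rightarrow> 'a set \<Rightarrow> 'a set" where
  "field_generators K R = {\<alpha> \<in> R. Q_adjoin \<alpha> = K}"

definition ring_generators :: "'a::comm_ring_1 set \<Rightarrow> 'a set" where
  "ring_generators R = {\<alpha> \<in> R. Z_adjoin \<alpha> = R}"

text \<open>The quotient field of a subring of a field, formed inside that field.\<close>
definition quotient_field :: "'a::field set \<Rightarrow> 'a set" where
  "quotient_field D = {a / b | a b. a \<in> D \<and> b \<in> D \<and> b \<noteq> 0}"

definition integer_valued_polys :: "'a::field set \<Rightarrow> 'a set \<Rightarrow> 'a poly set" where
  "integer_valued_polys S D =
     {f. (\<forall>i. coeff f i \<in> quotient_field D) \<and> (\<forall>x\<in>S. poly f x \<in> D)}"

definition polynomially_dense :: "'a::field set \<Rightarrow> 'a set \<Rightarrow> bool" where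
  "polynomially_dense S D \<longleftrightarrow>
     S \<subseteq> D \<and> integer_valued_polys S D = integer_valued_polys D D"

end

theory Submission
  imports Defs
begin

text \<open>
  Let \<open>f\<close> be integer-valued on the set \<open>S\<close> of field generators that are not ring generators, and let
  \<open>d > 0\<close> be an integer with \<open>d f \<in> R[X]\<close>.  Then \<open>f(x) - f(\<beta>) \<in> R\<close> whenever \<open>x \<equiv> \<beta>\<close> modulo \<open>d R\<close>,
  so it is enough that \<open>S\<close> meets every residue class modulo \<open>d R\<close>.  Given \<open>\<beta>\<close>, choose \<open>\<gamma> \<in> R\<close> such
  that \<open>\<beta> + d \<gamma>\<close> generates \<open>K\<close> and put \<open>x = (d + 1) (\<beta> + d \<gamma>)\<close>.  As \<open>x\<close> lies in \<open>m R\<close> for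
  \<open>m = d + 1 \<ge> 2\<close>, the ring \<open>Z[x]\<close> is contained in \<open>Z + m R\<close>, which is smaller than \<open>R\<close> because \<open>R\<close>
  has rank at least 2.

  The generator \<open>\<beta> + d \<gamma>\<close> comes from the following form of the primitive element theorem: for
  \<open>c, a \<in> K\<close> choose \<open>P \<noteq> 0\<close> in \<open>Q[t][X]\<close> of minimal degree in \<open>X\<close> with \<open>P(t, c + t a) = 0\<close>.
  Differentiating in \<open>t\<close> gives \<open>P\<^sub>t + a P\<^sub>X = 0\<close> along \<open>X = c + t a\<close>, where \<open>P\<^sub>X(t, c + t a)\<close> is not the
  zero polynomial by minimality; so \<open>a \<in> Q(c + k a)\<close> for all but finitely many integers \<open>k\<close>.
\<close>

section \<open>Subrings, subfields and spans\<close>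

interpretation qv: vector_space "scale_rat :: rat \<Rightarrow> 'a::field_char_0 \<Rightarrow> 'a"
  by (rule vector_space_scale_rat)

interpretation zm: module "scale_int :: int \<Rightarrow> 'a::ring_1 \<Rightarrow> 'a"
  by (rule module_scale_int)

context
  fixes R :: "'a::ring_1 set"
  assumes R: "is_subring R"
begin

lemma subring_one: "1 \<in> R"
  using R by (simp add: is_subring_def)

lemma subring_diff: "x \<in> R \<Longrightarrow> y \<in> R \<Longrightarrow> x - y \<in> R"
  using R by (simp add: is_subring_def)

lemma subring_mult: "x \<in> R \<Longrightarrow> y \<in> R \<Longrightarrow> x * y \<in> R"
  using R by (simp add: is_subring_def)

lemma subring_zero: "0 \<in> R"
  using subring_diff[OF subring_one subring_one] by simp

lemma subring_uminus: "x \<in> R \<Longrightarrow> - x \<in> R"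
  using subring_diff[OF subring_zero] by fastforce

lemma subring_add: "x \<in> R \<Longrightarrow> y \<in> R \<Longrightarrow> x + y \<in> R"
  using subring_diff[OF _ subring_uminus, of x y] by simp

lemma subring_of_nat: "of_nat k \<in> R"
  by (induction k) (auto intro: subring_zero subring_one subring_add)

lemma subring_of_int: "of_int k \<in> R"
  by (cases k) (auto intro: subring_of_nat subring_uminus simp del: of_nat_Suc)

lemma subring_sum: "(\<And>i. i \<in> A \<Longrightarrow> f i \<in> R) \<Longrightarrow> sum f A \<in> R"
  by (induction A rule: infinite_finite_induct) (auto intro: subring_zero subring_add)

end

lemma subring_poly:
  fixes R :: "'a::comm_ring_1 set"
  assumes "is_subring R" "\<And>i. coeff p i \<in> R" "x \<in> R"
  shows "poly p x \<in> R"
  using assms(2)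
proof (induction p)
  case 0
  show ?case using subring_zero[OF assms(1)] by simp
next
  case (pCons a p)
  have "a \<in> R" "\<And>i. coeff p i \<in> R"
    using pCons.prems[of 0] pCons.prems[of "Suc _"] by auto
  with pCons.IH show ?case
    by (auto intro!: subring_add subring_mult assms(1,3))
qed

text \<open>The cofactor stays in R. So if d f has coefficients in R for a nonzero integer d, and x
  - y lies in d R, cancelling d in characteristic 0 puts f(x) - f(y) in R.\<close>

lemma subring_poly_diff:
  fixes R :: "'a::comm_ring_1 set"
  assumes R: "is_subring R" and p: "\<And>i. coeff p i \<in> R" and xy: "x \<in> R" "y \<in> R"
  shows "\<exists>r\<in>R. poly p x - poly p y = (x - y) * r"
  using p
proof (induction p)
  case 0
  show ?case using subring_zero[OF R] by (intro bexI[of _ 0]) auto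
next
  case (pCons a p)
  have p: "\<And>i. coeff p i \<in> R"
    using pCons.prems[of "Suc _"] by auto
  with pCons.IH obtain r where r: "r \<in> R" "poly p x - poly p y = (x - y) * r"
    by auto
  have "poly (pCons a p) x - poly (pCons a p) y
      = (x - y) * poly p x + y * (poly p x - poly p y)"
    by (simp add: algebra_simps)
  also have "\<dots> = (x - y) * (poly p x + y * r)"
    unfolding r(2) by (simp add: algebra_simps)
  finally show ?case
    using subring_add[OF R subring_poly[OF R p xy(1)] subring_mult[OF R xy(2) r(1)]] by blast
qed

context
  fixes L :: "'a::field_char_0 set"
  assumes L: "is_subfield L"
begin

lemma subfield_subring: "is_subring L"
  using L by (simp add: is_subfield_def)

lemma subfield_divide: "x \<in> L \<Longrightarrow> y \<in> L \<Longrightarrow> x / y \<in> L"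
  using L subring_mult[OF subfield_subring] by (simp add: is_subfield_def divide_inverse)

lemma subfield_of_rat: "of_rat q \<in> L"
  by (cases q) (simp add: of_rat_rat subfield_divide subring_of_int[OF subfield_subring])

lemma subfield_span: "B \<subseteq> L \<Longrightarrow> qv.span B \<subseteq> L"
proof (rule qv.span_minimal)
  show "qv.subspace L"
    unfolding qv.subspace_def scale_rat_def
    using subfield_subring subfield_of_rat
    by (auto intro: subring_zero subring_add subring_mult)
qed

end

section \<open>A quantitative primitive element theorem\<close>

text \<open>Families instead of sets, because the products t^i (c + t a)^j to which this is applied
  may coincide. A repeated value gives v i - v j = 0; otherwise the image has too many elements to
  be independent in \<open>span T\<close>.\<close>

lemma (in vector_space) family_dependent:
  assumes "finite I" "finite T" "v ` I \<subseteq> span T" "card T < card I"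
  shows "\<exists>u. (\<exists>i\<in>I. u i \<noteq> 0) \<and> (\<Sum>i\<in>I. u i *s v i) = 0"
proof (cases "inj_on v I")
  case True
  have "dependent (v ` I)"
    using independent_span_bound[OF assms(2) _ assms(3)] assms(4) card_image[OF True] by auto
  then obtain u where "\<exists>w\<in>v ` I. u w \<noteq> 0" "(\<Sum>w\<in>v ` I. u w *s w) = 0"
    using dependent_finite[of "v ` I"] assms(1) by auto
  then show ?thesis
    by (intro exI[of _ "u \<circ> v"]) (auto simp: sum.reindex[OF True])
next
  case False
  then obtain i j where ij: "i \<in> I" "j \<in> I" "i \<noteq> j" "v i = v j"
    by (auto simp: inj_on_def)
  let ?u = "\<lambda>k. if k = i then 1 else if k = j then - 1 else 0"
  have "(\<Sum>k\<in>I. ?u k *s v k) = (\<Sum>k\<in>{i, j}. ?u k *s v k)"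
    using assms(1) ij by (intro sum.mono_neutral_right) auto
  also have "\<dots> = 0"
    using ij by simp
  finally show ?thesis
    using ij by (intro exI[of _ ?u]) auto
qed

section \<open>Evaluation of Q[t][X] along the line X = c + t a\<close>

abbreviation rat_poly :: "rat poly \<Rightarrow> 'a::field_char_0 poly" where
  "rat_poly \<equiv> map_poly of_rat"

lemma rat_poly_add: "rat_poly (p + q) = rat_poly p + rat_poly q"
  by (rule poly_eqI) (simp add: coeff_map_poly of_rat_add)

lemma rat_poly_pderiv: "rat_poly (pderiv p) = pderiv (rat_poly p)"
  by (rule poly_eqI) (simp add: coeff_map_poly coeff_pderiv of_rat_mult of_rat_add)

text \<open>The value \<open>P(t, c + t a)\<close>, a polynomial in \<open>t\<close>, of \<open>P \<in> Q[t][X]\<close>.\<close>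

definition line_eval :: "'a::field_char_0 \<Rightarrow> 'a \<Rightarrow> rat poly poly \<Rightarrow> 'a poly" where
  "line_eval c a P = poly (map_poly rat_poly P) [:c, a:]"

lemma line_eval_0 [simp]: "line_eval c a 0 = 0"
  by (simp add: line_eval_def)

lemma line_eval_pCons [simp]:
  "line_eval c a (pCons p P) = rat_poly p + [:c, a:] * line_eval c a P"
  by (simp add: line_eval_def map_poly_pCons)

lemma line_eval_add: "line_eval c a (P + Q) = line_eval c a P + line_eval c a Q"
  by (induction P Q rule: poly_induct2) (simp_all add: rat_poly_add algebra_simps)

lemma line_eval_sum: "line_eval c a (sum F A) = (\<Sum>i\<in>A. line_eval c a (F i))"
  by (induction A rule: infinite_finite_induct) (simp_all add: line_eval_add)

lemma line_eval_monom: "line_eval c a (monom p j) = rat_poly p * [:c, a:] ^ j"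
  by (induction j) (simp_all add: monom_0 monom_Suc algebra_simps)

text \<open>Chain rule: \<open>map_poly pderiv\<close> differentiates the coefficients, hence in t,
  and \<open>pderiv\<close> differentiates in X.\<close>

lemma pderiv_line_eval:
  "pderiv (line_eval c a P) = line_eval c a (map_poly pderiv P) + smult a (line_eval c a (pderiv P))"
proof (induction P)
  case 0
  show ?case by simp
next
  case (pCons p P)
  have "pderiv [:c, a:] = [:a:]"
    by (simp add: pderiv_pCons)
  then have "pderiv (line_eval c a (pCons p P)) =
      rat_poly (pderiv p) + ([:c, a:] * pderiv (line_eval c a P) + line_eval c a P * [:a:])"
    by (simp only: line_eval_pCons pderiv_add pderiv_mult rat_poly_pderiv)
  also have "\<dots> = rat_poly (pderiv p) + [:c, a:] * line_eval c a (map_poly pderiv P)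
      + smult a (line_eval c a P + [:c, a:] * line_eval c a (pderiv P))"
    unfolding pCons.IH by (simp add: algebra_simps smult_add_right)
  also have "\<dots> = line_eval c a (map_poly pderiv (pCons p P))
      + smult a (line_eval c a (pderiv (pCons p P)))"
    by (simp only: map_poly_pCons pderiv_0 line_eval_pCons pderiv_pCons line_eval_add) simp
  finally show ?case .
qed

text \<open>At t = k the value is P(k, c + k a), a combination of powers of c + k a with rational
  coefficients.\<close>

lemma poly_line_eval_in_subfield:
  assumes L: "is_subfield L" and x: "c + of_int k * a \<in> L"
  shows "poly (line_eval c a P) (of_int k) \<in> L"
proof (induction P)
  case 0
  show ?case using subring_zero[OF subfield_subring[OF L]] by simp
next
  case (pCons p P)
  note L' = subfield_subring[OF L]
  have "poly (rat_poly p) (of_int k) \<in> L"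
    by (rule subring_poly[OF L' _ subring_of_int[OF L']])
      (simp add: coeff_map_poly subfield_of_rat[OF L])
  moreover have "poly (line_eval c a (pCons p P)) (of_int k)
      = poly (rat_poly p) (of_int k) + (c + of_int k * a) * poly (line_eval c a P) (of_int k)"
    by (simp add: algebra_simps)
  ultimately show ?case
    using pCons.IH x by (simp only: subring_add[OF L'] subring_mult[OF L'])
qed

section \<open>The algebraic relation between t and c + t a, and primitive elements\<close>

lemma coeff_power_in_subring:
  fixes p :: "'a::comm_ring_1 poly"
  assumes K: "is_subring K" and "\<And>i. coeff p i \<in> K"
  shows "coeff (p ^ n) i \<in> K"
proof (induction n arbitrary: i)
  case 0
  show ?case using K by (auto simp: coeff_1 intro: subring_zero subring_one)
next
  case (Suc n)
  then show ?case
    unfolding power_Suc coeff_mult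
    by (intro subring_sum[OF K] subring_mult[OF K] assms(2))
qed

text \<open>Dimension count over Q: the products t^i (c + t a)^j with i \<le> n^2 and j \<le> n lie
  in the space of polynomials over K of degree at most n^2 + n, and are too many to be
  independent.\<close>

lemma line_eval_not_inj:
  assumes K: "is_subring K" and B: "finite B" "qv.span B = K" and ca: "c \<in> K" "a \<in> K"
  shows "\<exists>P. P \<noteq> 0 \<and> line_eval c a P = 0"
proof -
  interpret pv: vector_space "\<lambda>q (p :: 'a poly). smult (of_rat q) p"
    by unfold_locales (simp_all add: smult_add_right smult_add_left of_rat_add of_rat_mult)
  define n where "n = card B"
  \<comment> \<open>With this degree bound \<open>T\<close> has at most n (n^2 + n + 1) elements,
    one less than the (n^2 + 1) (n + 1) elements of \<open>I\<close>.\<close>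
  define D where "D = n * n + n"
  define I where "I = {..n * n} \<times> {..n}"
  define v :: "nat \<times> nat \<Rightarrow> 'a poly" where "v = (\<lambda>(i, j). monom 1 i * [:c, a:] ^ j)"
  define T where "T = (\<lambda>(b, j). monom b j) ` (B \<times> {..D})"
  have "card T \<le> card (B \<times> {..D})"
    unfolding T_def using B(1) by (intro card_image_le) auto
  also have "\<dots> < card I"
    by (simp add: I_def D_def n_def card_cartesian_product algebra_simps)
  finally have card: "card T < card I" .
  have monom: "monom x j \<in> pv.span T" if x: "x \<in> K" and j: "j \<le> D" for x j
  proof -
    from x B have "x \<in> range (\<lambda>u. \<Sum>b\<in>B. scale_rat (u b) b)"
      by (simp add: qv.span_finite)
    then obtain u where u: "x = (\<Sum>b\<in>B. scale_rat (u b) b)"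
      by auto
    have "monom x j = (\<Sum>b\<in>B. smult (of_rat (u b)) (monom b j))"
      by (rule poly_eqI) (simp add: u coeff_sum scale_rat_def)
    also have "\<dots> \<in> pv.span T"
      using j by (intro pv.span_sum pv.span_scale pv.span_base) (auto simp: T_def)
    finally show ?thesis .
  qed
  have "v ` I \<subseteq> pv.span T"
  proof clarify
    fix i j assume ij: "(i, j) \<in> I"
    have "coeff [:c, a:] k \<in> K" for k
      using ca subring_zero[OF K] by (auto simp: coeff_pCons split: nat.split)
    then have coeff: "coeff (v (i, j)) k \<in> K" for k
      using coeff_power_in_subring[OF K] subring_zero[OF K]
      by (simp add: v_def coeff_monom_mult)
    have "degree (v (i, j)) \<le> degree (monom (1::'a) i) + degree ([:c, a:] ^ j)"
      unfolding v_def by (simp add: degree_mult_le)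
    also have "\<dots> \<le> i + j"
      using degree_power_le[of "[:c, a:]" j] degree_monom_le[of "1::'a" i]
      by (auto intro!: add_mono elim!: order_trans)
    also have "\<dots> \<le> D"
      using ij by (auto simp: I_def D_def)
    finally have "v (i, j) = (\<Sum>k\<le>D. monom (coeff (v (i, j)) k) k)"
      by (simp add: poly_as_sum_of_monoms')
    also have "\<dots> \<in> pv.span T"
      using coeff monom by (intro pv.span_sum) auto
    finally show "v (i, j) \<in> pv.span T" .
  qed
  moreover have "finite I" "finite T"
    using B by (auto simp: I_def T_def)
  ultimately obtain u where u: "\<exists>i\<in>I. u i \<noteq> 0" "(\<Sum>i\<in>I. smult (of_rat (u i)) (v i)) = 0"
    using pv.family_dependent[of I T v] card by blast
  \<comment> \<open>The coefficient of the relation at (i, j) becomes the coefficient of t^i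
    X^j.\<close>
  define P where "P = (\<Sum>(i, j)\<in>I. monom (monom (u (i, j)) i) j)"
  have "line_eval c a P = (\<Sum>i\<in>I. smult (of_rat (u i)) (v i))"
    unfolding P_def line_eval_sum
    by (intro sum.cong refl)
      (auto simp: line_eval_monom v_def map_poly_monom smult_monom mult_smult_left[symmetric]
        simp del: mult_smult_left)
  moreover have "P \<noteq> 0"
  proof
    assume P: "P = 0"
    obtain i j where ij: "(i, j) \<in> I" "u (i, j) \<noteq> 0"
      using u(1) by auto
    have "coeff (coeff P j) i = (\<Sum>q\<in>I. if q = (i, j) then u q else 0)"
      unfolding P_def coeff_sum by (intro sum.cong refl) (auto split: if_splits)
    also have "\<dots> = u (i, j)"
      using ij \<open>finite I\<close> by simp
    finally show False
      using P ij by simp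
  qed
  ultimately show ?thesis
    using u(2) by auto
qed

text \<open>Quantifying over all subfields L that contain c + k a expresses a \<in> Q(c + k a). The
  exceptional k are roots of P_X(t, c + t a).\<close>

lemma finite_nongenerating_multiples:
  assumes "is_subring K" "finite B" "qv.span B = K" "c \<in> K" "a \<in> K"
  shows "finite {k :: int. \<not> (\<forall>L. is_subfield L \<longrightarrow> c + of_int k * a \<in> L \<longrightarrow> a \<in> L)}"
proof -
  let ?Q = "\<lambda>P. P \<noteq> 0 \<and> line_eval c a P = 0"
  obtain P where P: "?Q P" and min: "\<And>P'. ?Q P' \<Longrightarrow> degree P \<le> degree P'"
    using line_eval_not_inj[OF assms] ex_has_least_nat[of ?Q _ degree] by metis
  \<comment> \<open>Were P constant in X, it would be a nonzero p(t), which cannot vanish on the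
    line. Hence P_X is nonzero of smaller degree in X.\<close>
  have "degree P \<noteq> 0"
  proof
    assume "degree P = 0"
    then obtain p where p: "P = [:p:]"
      by (auto elim: degree_eq_zeroE)
    with P have "rat_poly p = (0 :: 'a poly)" "p \<noteq> 0"
      by auto
    then show False
      by (metis coeff_map_poly coeff_0 leading_coeff_0_iff of_rat_0 of_rat_eq_0_iff)
  qed
  then have "pderiv P \<noteq> 0" "degree (pderiv P) < degree P"
    by (auto simp: pderiv_eq_0_iff degree_pderiv)
  with min[of "pderiv P"] have PX: "line_eval c a (pderiv P) \<noteq> 0"
    by auto
  have rel: "line_eval c a (map_poly pderiv P) + smult a (line_eval c a (pderiv P)) = 0"
    using pderiv_line_eval[of c a P] P by simp
  have gen: "a \<in> L"
    if k: "poly (line_eval c a (pderiv P)) (of_int k) \<noteq> 0"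
      and L: "is_subfield L" "c + of_int k * a \<in> L" for k L
  proof -
    have "poly (line_eval c a (map_poly pderiv P)) (of_int k)
        + a * poly (line_eval c a (pderiv P)) (of_int k) = 0"
      using arg_cong[OF rel, of "\<lambda>p. poly p (of_int k)"] by simp
    then have "a = (0 - poly (line_eval c a (map_poly pderiv P)) (of_int k))
        / poly (line_eval c a (pderiv P)) (of_int k)"
      using k by (simp add: field_simps eq_neg_iff_add_eq_0)
    also have "\<dots> \<in> L"
      using subfield_subring[OF L(1)]
      by (intro subfield_divide[OF L(1)] subring_diff subring_zero poly_line_eval_in_subfield[OF L])
    finally show ?thesis .
  qed
  have "finite (of_int -` {x :: 'a. poly (line_eval c a (pderiv P)) x = 0} :: int set)"
    by (intro finite_vimageI poly_roots_finite PX) (simp add: inj_on_def)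
  then show ?thesis
    by (rule rev_finite_subset) (use gen in auto)
qed

text \<open>The elements of A are absorbed one at a time: replacing \<gamma> by \<gamma> + k
  \<alpha> adds k d \<alpha> to the generator, and for all but finitely many k the element d
  \<alpha> can be recovered from the sum.\<close>

lemma primitive_element_in_residue_class:
  assumes K: "is_subring K" "finite B" "qv.span B = K"
    and R: "is_subring R" "R \<subseteq> K" and \<beta>: "\<beta> \<in> R" and d: "d \<noteq> (0::int)"
    and A: "finite A" "A \<subseteq> R"
  shows "\<exists>\<gamma>\<in>R. \<forall>L. is_subfield L \<longrightarrow> \<beta> + of_int d * \<gamma> \<in> L \<longrightarrow> A \<subseteq> L"
  using A
proof (induction A rule: finite_induct)
  case empty
  show ?case using \<beta> by auto
next
  case (insert \<alpha> A)
  from insert obtain \<gamma> where \<gamma>: "\<gamma> \<in> R"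
    and IH: "\<And>L. is_subfield L \<Longrightarrow> \<beta> + of_int d * \<gamma> \<in> L \<Longrightarrow> A \<subseteq> L"
    by auto
  define c where "c = \<beta> + of_int d * \<gamma>"
  define a where "a = of_int d * \<alpha>"
  have "c \<in> R" "a \<in> R"
    using insert.prems \<beta> \<gamma> unfolding c_def a_def
    by (auto intro!: subring_add[OF R(1)] subring_mult[OF R(1)] subring_of_int[OF R(1)])
  then have "finite {k :: int. \<not> (\<forall>L. is_subfield L \<longrightarrow> c + of_int k * a \<in> L \<longrightarrow> a \<in> L)}"
    using R(2) by (intro finite_nongenerating_multiples[OF K]) auto
  then obtain k :: int
    where k: "\<And>L. is_subfield L \<Longrightarrow> c + of_int k * a \<in> L \<Longrightarrow> a \<in> L"
    using ex_new_if_finite[OF infinite_UNIV_int] by blast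
  show ?case
  proof (intro bexI allI impI)
    show "\<gamma> + of_int k * \<alpha> \<in> R"
      using \<gamma> insert.prems
      by (auto intro!: subring_add[OF R(1)] subring_mult[OF R(1)] subring_of_int[OF R(1)])
  next
    fix L assume L: "is_subfield L" and "\<beta> + of_int d * (\<gamma> + of_int k * \<alpha>) \<in> L"
    then have x: "c + of_int k * a \<in> L"
      by (simp add: c_def a_def algebra_simps)
    note L' = subfield_subring[OF L] and a = k[OF L x]
    have "\<alpha> = a / of_int d"
      using d by (simp add: a_def)
    \<comment> \<open>Subtracting k a recovers the previous generator, so the induction hypothesis
      still yields A \<subseteq> L.\<close>
    moreover have "c = (c + of_int k * a) - of_int k * a"
      by simp
    then have "c \<in> L"
      by (metis L' x a subring_diff subring_mult subring_of_int)
    ultimately show "insert \<alpha> A \<subseteq> L"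
      using IH[OF L] a subfield_divide[OF L a subring_of_int[OF L']] by (auto simp: c_def)
  qed
qed

section \<open>Orders\<close>

lemma finite_common_multiple:
  fixes P :: "int \<Rightarrow> 'b \<Rightarrow> bool"
  assumes "finite A" "\<And>x. x \<in> A \<Longrightarrow> \<exists>d>0. P d x"
    and "\<And>d e x. P d x \<Longrightarrow> P (e * d) x"
  shows "\<exists>d>0. \<forall>x\<in>A. P d x"
  using assms(1,2)
proof (induction A rule: finite_induct)
  case empty
  show ?case by (auto intro: exI[of _ 1])
next
  case (insert x A)
  then obtain d e where "d > 0" "\<forall>x\<in>A. P d x" "e > 0" "P e x"
    by (metis insert_iff)
  then show ?case
    using assms(3)[of d _ e] assms(3)[of e x d] by (intro exI[of _ "e * d"]) (auto simp: mult.commute)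
qed

lemma common_denominator:
  fixes u :: "'b \<Rightarrow> rat"
  assumes "finite A"
  shows "\<exists>d>0. \<exists>k :: 'b \<Rightarrow> int. \<forall>x\<in>A. of_int d * u x = of_int (k x)"
proof -
  have "\<exists>d>0. \<forall>x\<in>A. of_int d * u x \<in> \<int>"
  proof (rule finite_common_multiple[OF assms])
    fix x
    obtain a b where "u x = Fract a b" "b > 0"
      by (metis Rat_cases)
    then show "\<exists>d>0. of_int d * u x \<in> \<int>"
      by (intro exI[of _ b]) (simp add: Fract_of_int_quotient)
  qed (simp add: mult.assoc)
  then obtain d where "d > 0" "\<forall>x\<in>A. of_int d * u x \<in> \<int>"
    by blast
  then show ?thesis
    by (intro exI[of _ d] conjI exI[of _ "\<lambda>x. \<lfloor>of_int d * u x\<rfloor>"]) simp_all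
qed

text \<open>Multiplying a rational relation by a common denominator makes it integral and keeps
  nonzero coefficients nonzero.\<close>

lemma int_independent_imp_rat_independent:
  fixes B :: "'a::field_char_0 set"
  assumes "finite B" "\<not> zm.dependent B"
  shows "\<not> qv.dependent B"
proof
  assume "qv.dependent B"
  then obtain u w where w: "w \<in> B" "u w \<noteq> 0" and u: "(\<Sum>b\<in>B. scale_rat (u b) b) = 0"
    using qv.dependent_finite[OF assms(1)] by auto
  obtain d k where d: "(d :: int) > 0"
    and k: "\<And>b. b \<in> B \<Longrightarrow> of_int d * u b = of_int (k b)"
    using common_denominator[OF assms(1), of u] by blast
  have "scale_int (k b) b = of_int d * scale_rat (u b) b" if "b \<in> B" for b
  proof -
    have "(of_int (k b) :: 'a) = of_rat (of_int d * u b)"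
      using k[OF that] by simp
    then show ?thesis
      by (simp add: scale_int_def scale_rat_def of_rat_mult mult.assoc)
  qed
  then have "(\<Sum>b\<in>B. scale_int (k b) b) = of_int d * (\<Sum>b\<in>B. scale_rat (u b) b)"
    by (simp add: sum_distrib_left)
  then have "(\<Sum>b\<in>B. scale_int (k b) b) = 0"
    using u by simp
  moreover have "k w \<noteq> 0"
    using k[OF w(1)] d w(2) by auto
  ultimately show False
    using assms w(1) zm.dependent_finite[OF assms(1)] by blast
qed

text \<open>An element of K outside the span could be added to B, giving an independent set with
  more elements than a basis of K.\<close>

lemma order_spans:
  assumes K: "number_field K" and B: "finite B" "card B = degree_over_Q K"
    and ind: "\<not> zm.dependent B" and sub: "B \<subseteq> K"
  shows "qv.span B = K"
proof
  show "qv.span B \<subseteq> K"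
    using K sub subfield_span[of K B] by (simp add: number_field_def)
  obtain C where C: "finite C" "qv.span C = K"
    using K by (auto simp: number_field_def)
  obtain E where E: "E \<subseteq> K" "\<not> qv.dependent E" "K \<subseteq> qv.span E" "card E = qv.dim K"
    using qv.basis_exists[of K] by blast
  have "finite E"
    using qv.independent_span_bound[OF C(1) E(2)] E(1) C(2) by auto
  have indB: "\<not> qv.dependent B"
    by (rule int_independent_imp_rat_independent[OF B(1) ind])
  show "K \<subseteq> qv.span B"
  proof
    fix x assume x: "x \<in> K"
    show "x \<in> qv.span B"
    proof (rule ccontr)
      assume nx: "x \<notin> qv.span B"
      then have "\<not> qv.dependent (insert x B)"
        using indB by (simp add: qv.independent_insert)
      then have "card (insert x B) \<le> card E"
        using qv.independent_span_bound[OF \<open>finite E\<close>, of "insert x B"] sub x E(3) by auto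
      moreover have "x \<notin> B"
        using nx qv.span_base by blast
      ultimately show False
        using B E(4) by (simp add: degree_over_Q_def)
    qed
  qed
qed

lemma order_denominator:
  fixes B :: "'a::field_char_0 set"
  assumes "finite B" "zm.span B = R" "qv.span B = K" "x \<in> K"
  shows "\<exists>d>0. of_int d * x \<in> R"
proof -
  obtain u where u: "x = (\<Sum>b\<in>B. scale_rat (u b) b)"
    using assms by (auto simp: qv.span_finite)
  obtain d k where d: "(d :: int) > 0"
    and k: "\<And>b. b \<in> B \<Longrightarrow> of_int d * u b = of_int (k b)"
    using common_denominator[OF assms(1), of u] by blast
  have "of_int d * scale_rat (u b) b = scale_int (k b) b" if "b \<in> B" for b
  proof -
    have "(of_int (k b) :: 'a) = of_rat (of_int d * u b)"
      using k[OF that] by simp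
    then show ?thesis
      by (simp add: scale_int_def scale_rat_def of_rat_mult mult.assoc)
  qed
  then have "of_int d * x = (\<Sum>b\<in>B. scale_int (k b) b)"
    by (simp add: u sum_distrib_left)
  also have "\<dots> \<in> R"
    using assms(1,2) by (auto simp: zm.span_finite)
  finally show ?thesis
    using d by blast
qed

text \<open>
  If \<open>b\<^sub>i = z\<^sub>i + m r\<^sub>i\<close> for two basis elements, then \<open>z\<^sub>2 b\<^sub>1 - z\<^sub>1 b\<^sub>2 \<in> m R\<close>, so \<open>m\<close> divides
  \<open>z\<^sub>1\<close> and hence \<open>b\<^sub>1 \<in> m R\<close>.
\<close>

lemma order_neq_int_plus_multiple:
  fixes B :: "'a::field_char_0 set"
  assumes B: "finite B" "\<not> zm.dependent B" "zm.span B = R" and card: "card B \<ge> 2"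
    and R: "is_subring R" and m: "(m :: int) \<ge> 2"
  shows "\<exists>y\<in>R. \<forall>z :: int. \<forall>r\<in>R. y \<noteq> of_int z + of_int m * r"
proof (rule ccontr)
  assume "\<not> ?thesis"
  then have all: "\<And>y. y \<in> R \<Longrightarrow> \<exists>z :: int. \<exists>r\<in>R. y = of_int z + of_int m * r"
    by blast
  \<comment> \<open>Integral coordinates in B are unique, so an element of m R has all coordinates
    divisible by m.\<close>
  have dvd: "m dvd u b"
    if u: "(\<Sum>b\<in>B. scale_int (u b) b) = of_int m * r" and r: "r \<in> R" and b: "b \<in> B" for u r b
  proof -
    obtain w where w: "r = (\<Sum>b\<in>B. scale_int (w b) b)"
      using r B by (auto simp: zm.span_finite)
    have *: "(\<Sum>b\<in>B. scale_int (u b - m * w b) b) = 0"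
      using u w
      by (simp add: scale_int_def sum_subtractf sum_distrib_left algebra_simps)
    have "u b - m * w b = 0"
    proof (rule ccontr)
      assume "u b - m * w b \<noteq> 0"
      then have "zm.dependent B"
        unfolding zm.dependent_finite[OF B(1)]
        using * b by (intro exI[of _ "\<lambda>b. u b - m * w b"]) blast
      with B(2) show False ..
    qed
    then show ?thesis by simp
  qed
  obtain b c where bc: "b \<in> B" "c \<in> B" "b \<noteq> c"
    using card card_le_Suc0_iff_eq[OF B(1)] by fastforce
  then have "b \<in> R" "c \<in> R"
    using B(3) zm.span_base by auto
  then obtain z r y s
    where b: "b = of_int z + of_int m * r" "r \<in> R" and c: "c = of_int y + of_int m * s" "s \<in> R"
    using all by meson
  have pair: "(\<Sum>v\<in>B. scale_int (if v = b then i else if v = c then j else 0) v)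
      = of_int i * b + of_int j * c" for i j
  proof -
    have "(\<Sum>v\<in>B. scale_int (if v = b then i else if v = c then j else 0) v)
        = (\<Sum>v\<in>{b, c}. scale_int (if v = b then i else if v = c then j else 0) v)"
      using bc B(1) by (intro sum.mono_neutral_right) (auto simp: scale_int_def)
    then show ?thesis
      using bc by (simp add: scale_int_def)
  qed
  have "(\<Sum>v\<in>B. scale_int (if v = b then y else if v = c then - z else 0) v)
      = of_int m * (of_int y * r - of_int z * s)"
    unfolding pair unfolding b(1) c(1) by (simp add: algebra_simps)
  moreover have "of_int y * r - of_int z * s \<in> R"
    using b c by (intro subring_diff[OF R] subring_mult[OF R] subring_of_int[OF R])
  ultimately have "m dvd (if c = b then y else if c = c then - z else 0)"
    by (rule dvd[OF _ _ bc(2)])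
  then obtain q where "z = m * q"
    using bc by (auto elim: dvdE)
  then have "b = of_int m * (of_int q + r)"
    using b(1) by (simp add: algebra_simps)
  \<comment> \<open>Now b lies in m R although its own coordinate is 1, so m would divide 1.\<close>
  then have "(\<Sum>v\<in>B. scale_int (if v = b then 1 else if v = c then 0 else 0) v)
      = of_int m * (of_int q + r)"
    unfolding pair by simp
  moreover have "of_int q + r \<in> R"
    using b by (intro subring_add[OF R] subring_of_int[OF R])
  ultimately have "m dvd (if b = b then 1 else if b = c then 0 else 0)"
    by (rule dvd[OF _ _ bc(1)])
  with m show False
    by auto
qed

lemma multiple_not_ring_generator:
  fixes B :: "'a::field_char_0 set"
  assumes B: "finite B" "\<not> zm.dependent B" "zm.span B = R" "card B \<ge> 2"
    and R: "is_subring R" and m: "(m :: int) \<ge> 2" and x: "x \<in> R"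
  shows "of_int m * x \<notin> ring_generators R"
proof
  assume "of_int m * x \<in> ring_generators R"
  then have gen: "Z_adjoin (of_int m * x) = R"
    by (simp add: ring_generators_def)
  obtain y where y: "y \<in> R" "\<And>z :: int. \<And>r. r \<in> R \<Longrightarrow> y \<noteq> of_int z + of_int m * r"
    using order_neq_int_plus_multiple[OF B R m] by blast
  from y(1) gen obtain p :: "int poly" where p: "y = poly (map_poly of_int p) (of_int m * x)"
    by (auto simp: Z_adjoin_def)
  \<comment> \<open>Splitting off the constant coefficient exhibits y as an element of Z + m
    R.\<close>
  obtain a q where "p = pCons a q"
    by (cases p)
  then have "y = of_int a + of_int m * (x * poly (map_poly of_int q) (of_int m * x))"
    by (simp add: p map_poly_pCons mult.assoc)
  moreover have "x * poly (map_poly of_int q) (of_int m * x) \<in> R"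
    using x by (intro subring_mult[OF R] subring_poly[OF R])
      (auto simp: coeff_map_poly subring_of_int[OF R])
  ultimately show False
    using y(2) by blast
qed

section \<open>Density of the field generators that do not generate the ring\<close>

lemma quotient_field_subset:
  fixes K :: "'a::field_char_0 set"
  shows "is_subfield K \<Longrightarrow> R \<subseteq> K \<Longrightarrow> quotient_field R \<subseteq> K"
  unfolding quotient_field_def using subfield_divide[of K] by (auto simp: subset_iff)

lemma field_generatorI:
  assumes K: "is_subfield K" and x: "x \<in> R" "R \<subseteq> K"
    and gen: "\<And>L. is_subfield L \<Longrightarrow> x \<in> L \<Longrightarrow> K \<subseteq> L"
  shows "x \<in> field_generators K R"
proof -
  have "Q_adjoin x = K"
    unfolding Q_adjoin_def by (rule hull_unique) (use assms in auto)
  with x show ?thesis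
    by (simp add: field_generators_def)
qed

theorem proposition2p1:
  fixes K R :: "'a::field_char_0 set" and n :: nat
  assumes "number_field K"
    and "degree_over_Q K = n"
    and "n \<ge> 2"
    and "is_order K R"
  shows "polynomially_dense (field_generators K R - ring_generators R) R"
proof -
  have K: "is_subfield K"
    using assms(1) by (simp add: number_field_def)
  have R: "is_subring R" "R \<subseteq> K"
    using assms(4) by (auto simp: is_order_def)
  obtain B where B: "finite B" "card B = degree_over_Q K" "\<not> zm.dependent B" "zm.span B = R"
    using assms(4) by (auto simp: is_order_def)
  have BR: "B \<subseteq> R"
    using B(4) zm.span_base by auto
  with R have spanB: "qv.span B = K"
    by (intro order_spans[OF assms(1) B(1-3)]) auto
  let ?S = "field_generators K R - ring_generators R"
  have "poly f \<beta> \<in> R" if f: "f \<in> integer_valued_polys ?S R" and \<beta>: "\<beta> \<in> R" for f \<beta>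
  proof -
    have "\<exists>d>0. \<forall>x\<in>set (coeffs f). of_int d * x \<in> R"
    proof (rule finite_common_multiple[where P = "\<lambda>d x. of_int d * x \<in> R"])
      fix x assume "x \<in> set (coeffs f)"
      then have "x \<in> K"
        using f quotient_field_subset[OF K R(2)]
        by (auto simp: integer_valued_polys_def coeffs_def split: if_splits)
      then show "\<exists>d>0. of_int d * x \<in> R"
        by (rule order_denominator[OF B(1,4) spanB])
    next
      fix d e :: int and x assume "of_int d * x \<in> R"
      then have "of_int e * (of_int d * x) \<in> R"
        by (rule subring_mult[OF R(1) subring_of_int[OF R(1)]])
      then show "of_int (e * d) * x \<in> R"
        by (simp add: mult.assoc)
    qed simp
    then obtain d :: int where d: "d > 0" "\<And>x. x \<in> set (coeffs f) \<Longrightarrow> of_int d * x \<in> R"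
      by auto
    have df: "coeff (smult (of_int d) f) i \<in> R" for i
    proof (cases "coeff f i = 0")
      case False
      then have "coeff f i \<in> set (coeffs f)"
        using range_coeff[of f] by blast
      then show ?thesis
        using d(2) by simp
    qed (simp add: subring_zero[OF R(1)])
    \<comment> \<open>The finite set is taken to be B: a subfield containing B contains its rational
      span K.\<close>
    obtain \<gamma> where \<gamma>: "\<gamma> \<in> R"
      and gen: "\<And>L. is_subfield L \<Longrightarrow> \<beta> + of_int d * \<gamma> \<in> L \<Longrightarrow> B \<subseteq> L"
      using primitive_element_in_residue_class
        [OF subfield_subring[OF K] B(1) spanB R \<beta> _ B(1) BR, of d] d(1)
      by auto
    define y where "y = \<beta> + of_int d * \<gamma>"
    \<comment> \<open>The factor d + 1 is 1 modulo d, so x stays in the class of \<beta>; it is at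
      least 2, and as a nonzero integer it does not change the generated field.\<close>
    define x where "x = of_int (d + 1) * y"
    have y: "y \<in> R"
      unfolding y_def
      by (intro subring_add[OF R(1)] subring_mult[OF R(1)] subring_of_int[OF R(1)] \<beta> \<gamma>)
    then have x: "x \<in> R"
      unfolding x_def by (intro subring_mult[OF R(1)] subring_of_int[OF R(1)])
    have "x \<in> field_generators K R"
    proof (rule field_generatorI[OF K x R(2)])
      fix L assume L: "is_subfield L" "x \<in> L"
      have "(of_int (d + 1) :: 'a) \<noteq> 0"
        using d(1) unfolding of_int_eq_0_iff by simp
      then have "y = x / of_int (d + 1)"
        by (simp add: x_def)
      then have "y \<in> L"
        using L subfield_divide[OF L(1) L(2) subring_of_int[OF subfield_subring[OF L(1)]]] by metis
      then show "K \<subseteq> L"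
        using gen[OF L(1)] subfield_span[OF L(1), of B] spanB by (simp add: y_def)
    qed
    \<comment> \<open>Degree at least 2 enters here as card B \<ge> 2. In degree 1 every integer
      generates the ring Z, and \<open>?S\<close> would be empty.\<close>
    moreover have "x \<notin> ring_generators R"
      unfolding x_def
      by (rule multiple_not_ring_generator[OF B(1,3,4) _ R(1) _ y]) (use B(2) assms(2,3) d(1) in auto)
    ultimately have fx: "poly f x \<in> R"
      using f by (auto simp: integer_valued_polys_def)
    have xb: "x - \<beta> = of_int d * (y + \<gamma>)"
      by (simp add: x_def y_def algebra_simps)
    obtain r where r: "r \<in> R"
      "poly (smult (of_int d) f) x - poly (smult (of_int d) f) \<beta> = (x - \<beta>) * r"
      using subring_poly_diff[OF R(1) df x \<beta>] by blast
    then have "of_int d * (poly f x - poly f \<beta>) = of_int d * ((y + \<gamma>) * r)"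
      unfolding xb by (simp add: algebra_simps)
    then have "poly f x - poly f \<beta> = (y + \<gamma>) * r"
      using d(1) unfolding mult_cancel_left by simp
    then have "poly f \<beta> = poly f x - (y + \<gamma>) * r"
      by (simp add: algebra_simps)
    also have "\<dots> \<in> R"
      by (intro subring_diff[OF R(1)] subring_mult[OF R(1)] subring_add[OF R(1)] fx y \<gamma> r)
    finally show ?thesis .
  qed
  \<comment> \<open>Restricting from R to \<open>?S\<close> gives the other inclusion.\<close>
  moreover have "?S \<subseteq> R"
    by (auto simp: field_generators_def)
  ultimately show ?thesis
    unfolding polynomially_dense_def by (auto simp: integer_valued_polys_def)
qed

end
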